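(* Let $x=x(s)$ be a regular curve in $\mathbb{E}^4$, parametrized by arclength $s$, with Frenet frame $V_1,V_2,V_3,V_4$ and nonzero Frenet curvatures $\kappa_1,\kappa_2,\kappa_3$. Let $\overline{x}=x+\lambda_1V_1+\lambda_2V_2+\lambda_3V_3$ be an involute of order $3$ of $x$. Then the Frenet $4$-frame and the Frenet curvatures of $\overline{x}$ are given by $$\overline{V}_1=V_4,\quad \overline{V}_2=-V_3,\quad \overline{V}_3=V_2,\quad \overline{V}_4=V_1,$$ and $$\overline{\kappa}_1=\frac{\kappa_3}{|\psi|},\qquad \overline{\kappa}_2=\frac{\kappa_2}{|\psi|},\qquad \overline{\kappa}_3=-\frac{\kappa_1}{|\psi|},$$ where $\psi(s)=\lambda_3(s)\kappa_3(s)$.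
   Context: For a curve $y$ in $\mathbb{E}^4$ with speed $v=\|y'\|$, the Frenet frame is an orthonormal frame $V_1=y'/\|y'\|,V_2,V_3,V_4$ along $y$, and the Frenet curvatures are functions $\kappa_1,\kappa_2,\kappa_3$, with $V_1'=v\kappa_1V_2$, $V_2'=v(-\kappa_1V_1+\kappa_2V_3)$, $V_3'=v(-\kappa_2V_2+\kappa_3V_4)$, $V_4'=-v\kappa_3V_3$. An involute of order $3$ of a unit speed curve $x$ is a curve $\overline{x}=x+\lambda_1V_1+\lambda_2V_2+\lambda_3V_3$ with differentiable $\lambda_i$ such that $\langle\overline{x}',V_j\rangle=0$ for $j=1,2,3$, i.e. $\lambda_1'=\kappa_1\lambda_2-1$, $\lambda_2'=\kappa_2\lambda_3-\kappa_1\lambda_1$, $\lambda_3'=-\kappa_2\lambda_2$.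
   Formalization: The involute is assumed regular (ψ nowhere zero); the stated frame is proved for ψ>0, while for ψ<0, where x̄'/‖x̄'‖=−V₄, all four frame vectors are negated, with the same curvatures; ψ is shown to have constant sign. *)

theory Defs
  imports "HOL-Analysis.Analysis"
begin

definition regular_curve_on :: "real set \<Rightarrow> (real \<Rightarrow> real ^ 4) \<Rightarrow> bool" where
  "regular_curve_on I y \<longleftrightarrow>
     (\<forall>s\<in>I. y differentiable (at s) \<and> vector_derivative y (at s) \<noteq> 0)"

definition speed :: "(real \<Rightarrow> real ^ 4) \<Rightarrow> real \<Rightarrow> real" where
  "speed y s = norm (vector_derivative y (at s))"

definition orthonormal4 :: "real ^ 4 \<Rightarrow> real ^ 4 \<Rightarrow> real ^ 4 \<Rightarrow> real ^ 4 \<Rightarrow> bool" where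
  "orthonormal4 a b c d \<longleftrightarrow>
     norm a = 1 \<and> norm b = 1 \<and> norm c = 1 \<and> norm d = 1 \<and>
     orthogonal a b \<and> orthogonal a c \<and> orthogonal a d \<and>
     orthogonal b c \<and> orthogonal b d \<and> orthogonal c d"

text \<open>
  The curvatures may have either sign and no orientation of the frame is imposed, so
  the frame and the curvatures are determined by the curve only up to changes of sign.
  This is therefore a predicate rather than a function of the curve.
\<close>

definition frenet_on ::
  "real set \<Rightarrow> (real \<Rightarrow> real ^ 4) \<Rightarrow>
   (real \<Rightarrow> real ^ 4) \<Rightarrow> (real \<Rightarrow> real ^ 4) \<Rightarrow> (real \<Rightarrow> real ^ 4) \<Rightarrow> (real \<Rightarrow> real ^ 4) \<Rightarrow>
   (real \<Rightarrow> real) \<Rightarrow> (real \<Rightarrow> real) \<Rightarrow> (real \<Rightarrow> real) \<Rightarrow> bool" where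
  "frenet_on I y V\<^sub>1 V\<^sub>2 V\<^sub>3 V\<^sub>4 \<kappa>\<^sub>1 \<kappa>\<^sub>2 \<kappa>\<^sub>3 \<longleftrightarrow>
     regular_curve_on I y \<and>
     (\<forall>s\<in>I.
        orthonormal4 (V\<^sub>1 s) (V\<^sub>2 s) (V\<^sub>3 s) (V\<^sub>4 s) \<and>
        V\<^sub>1 s = vector_derivative y (at s) /\<^sub>R speed y s \<and>
        (V\<^sub>1 has_vector_derivative speed y s *\<^sub>R (\<kappa>\<^sub>1 s *\<^sub>R V\<^sub>2 s)) (at s) \<and>
        (V\<^sub>2 has_vector_derivative speed y s *\<^sub>R (- \<kappa>\<^sub>1 s *\<^sub>R V\<^sub>1 s + \<kappa>\<^sub>2 s *\<^sub>R V\<^sub>3 s)) (at s) \<and>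
        (V\<^sub>3 has_vector_derivative speed y s *\<^sub>R (- \<kappa>\<^sub>2 s *\<^sub>R V\<^sub>2 s + \<kappa>\<^sub>3 s *\<^sub>R V\<^sub>4 s)) (at s) \<and>
        (V\<^sub>4 has_vector_derivative speed y s *\<^sub>R (- \<kappa>\<^sub>3 s *\<^sub>R V\<^sub>3 s)) (at s))"

definition involute3_on ::
  "real set \<Rightarrow> (real \<Rightarrow> real ^ 4) \<Rightarrow>
   (real \<Rightarrow> real ^ 4) \<Rightarrow> (real \<Rightarrow> real ^ 4) \<Rightarrow> (real \<Rightarrow> real ^ 4) \<Rightarrow>
   (real \<Rightarrow> real) \<Rightarrow> (real \<Rightarrow> real) \<Rightarrow> (real \<Rightarrow> real) \<Rightarrow> (real \<Rightarrow> real ^ 4) \<Rightarrow> bool" where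
  "involute3_on I x V\<^sub>1 V\<^sub>2 V\<^sub>3 l\<^sub>1 l\<^sub>2 l\<^sub>3 z \<longleftrightarrow>
     (\<forall>s\<in>I.
        l\<^sub>1 differentiable (at s) \<and> l\<^sub>2 differentiable (at s) \<and> l\<^sub>3 differentiable (at s) \<and>
        z s = x s + l\<^sub>1 s *\<^sub>R V\<^sub>1 s + l\<^sub>2 s *\<^sub>R V\<^sub>2 s + l\<^sub>3 s *\<^sub>R V\<^sub>3 s \<and>
        vector_derivative z (at s) \<bullet> V\<^sub>1 s = 0 \<and>
        vector_derivative z (at s) \<bullet> V\<^sub>2 s = 0 \<and>
        vector_derivative z (at s) \<bullet> V\<^sub>3 s = 0)"

end

theory Submission
  imports Defs
begin

text \<open>
  Expanding the derivative of the involute in the frame of \<open>x\<close> leaves only the component along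
  \<open>V\<^sub>4\<close>, which is \<open>\<psi>\<close>; everything then follows by rescaling the Frenet equations of \<open>x\<close>, once \<open>\<psi>\<close>
  is known to have constant sign. As \<open>\<kappa>\<^sub>3\<close> is not assumed continuous, this needs an argument: near
  \<open>t\<close>, the function \<open>s \<mapsto> \<psi> s * (V\<^sub>4 s \<bullet> V\<^sub>4 t)\<close> is a nonvanishing derivative, hence has constant sign
  by Darboux's theorem, and its second factor is positive by continuity.
\<close>

text \<open>Darboux's argument: \<open>g'\<close> need not be continuous, so the zero comes from a
  maximum of \<open>g\<close> on the compact interval. The endpoint signs make \<open>g\<close> grow
  when moving inward from \<open>a\<close> or from \<open>b\<close>, so the maximum is
  interior.\<close>

lemma DERIV_pos_neg_imp_zero:
  fixes g g' :: "real \<Rightarrow> real"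
  assumes "a < b"
    and der: "\<And>x. x \<in> {a..b} \<Longrightarrow> (g has_real_derivative g' x) (at x)"
    and "g' a > 0" "g' b < 0"
  shows "\<exists>c\<in>{a..b}. g' c = 0"
proof -
  have "continuous_on {a..b} g"
    by (intro continuous_at_imp_continuous_on ballI DERIV_isCont[OF der])
  then have "\<exists>c\<in>{a..b}. \<forall>x\<in>{a..b}. g x \<le> g c"
    using \<open>a < b\<close> by (intro continuous_attains_sup) simp_all
  then obtain c where c: "c \<in> {a..b}" "\<And>x. x \<in> {a..b} \<Longrightarrow> g x \<le> g c"
    by blast
  have "c \<noteq> a"
  proof
    assume "c = a"
    obtain d where d: "d > 0" "\<And>h. 0 < h \<Longrightarrow> h < d \<Longrightarrow> g a < g (a + h)"
      using DERIV_pos_inc_right[OF der[of a] \<open>g' a > 0\<close>] \<open>a < b\<close> by force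
    \<comment> \<open>Halving gives the strict bound \<open>h < d\<close>; the cap
      \<open>b - a\<close> keeps \<open>a + h\<close> in the interval.\<close>
    define h where "h = min (d / 2) (b - a)"
    have "0 < h" "h < d" "a + h \<in> {a..b}"
      using d(1) \<open>a < b\<close> by (auto simp: h_def)
    then show False
      using d(2)[of h] c(2)[of "a + h"] \<open>c = a\<close> by simp
  qed
  moreover have "c \<noteq> b"
  proof
    assume "c = b"
    obtain d where d: "d > 0" "\<And>h. 0 < h \<Longrightarrow> h < d \<Longrightarrow> g b < g (b - h)"
      using DERIV_neg_dec_left[OF der[of b] \<open>g' b < 0\<close>] \<open>a < b\<close> by force
    define h where "h = min (d / 2) (b - a)"
    have "0 < h" "h < d" "b - h \<in> {a..b}"
      using d(1) \<open>a < b\<close> by (auto simp: h_def)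
    then show False
      using d(2)[of h] c(2)[of "b - h"] \<open>c = b\<close> by simp
  qed
  \<comment> \<open>This radius fits inside the interval, so the maximum over the interval is a
    local maximum on the whole line.\<close>
  ultimately have "0 < min (c - a) (b - c)"
    using c(1) by auto
  moreover have "\<forall>y. \<bar>c - y\<bar> < min (c - a) (b - c) \<longrightarrow> g y \<le> g c"
    by (intro allI impI c(2)) auto
  ultimately have "g' c = 0"
    by (rule DERIV_local_max[OF der[OF c(1)]])
  then show ?thesis using c(1) by blast
qed

text \<open>Opposite signs of \<open>g'\<close> at two points would force a zero of
  \<open>g'\<close> between them, and that zero lies in \<open>J\<close> because \<open>J\<close> is
  an interval.\<close>

lemma DERIV_nonzero_imp_sgn_eq:
  fixes g g' :: "real \<Rightarrow> real"
  assumes "is_interval J"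
    and der: "\<And>x. x \<in> J \<Longrightarrow> (g has_real_derivative g' x) (at x)"
    and nz: "\<And>x. x \<in> J \<Longrightarrow> g' x \<noteq> 0"
    and "a \<in> J" "b \<in> J"
  shows "sgn (g' a) = sgn (g' b)"
proof -
  have *: "sgn (g' p) = sgn (g' q)" if "p \<in> J" "q \<in> J" "p < q" for p q
  proof (rule ccontr)
    assume neq: "sgn (g' p) \<noteq> sgn (g' q)"
    have sub: "{p..q} \<subseteq> J"
      using mem_is_interval_1_I[OF \<open>is_interval J\<close> that(1,2)] by auto
    have "g' p \<noteq> 0" "g' q \<noteq> 0"
      using nz that by blast+
    with neq have "g' p > 0 \<and> g' q < 0 \<or> g' p < 0 \<and> g' q > 0"
      by (simp add: sgn_if split: if_splits)
    then consider "g' p > 0" "g' q < 0" | "g' p < 0" "g' q > 0"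
      by blast
    then have "\<exists>c\<in>{p..q}. g' c = 0"
    proof cases
      case 1
      then show ?thesis
        using sub by (intro DERIV_pos_neg_imp_zero[OF \<open>p < q\<close>, of g] der) auto
    next
      case 2
      \<comment> \<open>Passing to \<open>- g\<close> turns a change from negative to positive into
        the reverse.\<close>
      have "\<exists>c\<in>{p..q}. - g' c = 0"
        using 2 sub
        by (intro DERIV_pos_neg_imp_zero[OF \<open>p < q\<close>, of "\<lambda>x. - g x"] DERIV_minus der) auto
      then show ?thesis by simp
    qed
    then show False using nz sub by blast
  qed
  show ?thesis
  proof (cases a b rule: linorder_cases)
    case less
    then show ?thesis by (intro * assms)
  next
    case equal
    then show ?thesis by simp
  next
    case greater
    then show ?thesis by (intro *[symmetric] assms)
  qed
qed

text \<open>A locally constant function on a connected set is constant, so only the sign near each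
  \<open>t\<close> matters. Continuity is asked of the direction \<open>v\<close> alone, not of the
  factor \<open>p\<close>, which will be \<psi>.\<close>

lemma vector_derivative_direction_sgn_eq:
  fixes y v :: "real \<Rightarrow> 'a::real_inner" and p :: "real \<Rightarrow> real"
  assumes "open I" "is_interval I"
    and der: "\<And>s. s \<in> I \<Longrightarrow> (y has_vector_derivative p s *\<^sub>R v s) (at s)"
    and cont: "continuous_on I v"
    and nz: "\<And>s. s \<in> I \<Longrightarrow> p s *\<^sub>R v s \<noteq> 0"
    and "a \<in> I" "b \<in> I"
  shows "sgn (p a) = sgn (p b)"
proof (rule connected_local_const[of I a b "\<lambda>s. sgn (p s)"])
  show "connected I"
    using \<open>is_interval I\<close> is_interval_connected by blast
  show "\<forall>t\<in>I. \<forall>\<^sub>F s in at t within I. sgn (p t) = sgn (p s)"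
  proof
    fix t assume "t \<in> I"
    have "continuous_on I (\<lambda>s. v s \<bullet> v t)"
      by (intro continuous_intros cont)
    then have "isCont (\<lambda>s. v s \<bullet> v t) t"
      using \<open>open I\<close> \<open>t \<in> I\<close> by (simp add: continuous_on_eq_continuous_at)
    moreover have "v t \<bullet> v t > 0"
      using nz[OF \<open>t \<in> I\<close>] by auto
    ultimately have "\<forall>\<^sub>F s in nhds t. v s \<bullet> v t > 0"
      \<comment> \<open>Replacing the punctured filter \<open>at t\<close> by \<open>nhds t\<close>
        includes \<open>t\<close> itself, so a full ball can be extracted.\<close>
      unfolding isCont_def tendsto_at_iff_tendsto_nhds[of "\<lambda>s. v s \<bullet> v t" t]
      by (rule order_tendstoD(1))
    moreover have "\<forall>\<^sub>F s in nhds t. s \<in> I"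
      using \<open>open I\<close> \<open>t \<in> I\<close> by (simp add: eventually_nhds_in_open)
    ultimately have "\<forall>\<^sub>F s in nhds t. s \<in> I \<and> v s \<bullet> v t > 0"
      by eventually_elim simp
    then obtain d where "d > 0" and d: "\<And>s. s \<in> ball t d \<Longrightarrow> s \<in> I \<and> v s \<bullet> v t > 0"
      unfolding eventually_nhds_metric by (auto simp: dist_commute)
    have "sgn (p t) = sgn (p s)" if "s \<in> ball t d" for s
    proof -
      \<comment> \<open>Projecting \<open>y\<close> onto the fixed vector \<open>v t\<close> gives a
        scalar function whose derivative is computed without differentiating
        \<open>v\<close>.\<close>
      have "sgn (p t * (v t \<bullet> v t)) = sgn (p s * (v s \<bullet> v t))"
      proof (rule DERIV_nonzero_imp_sgn_eq[of "ball t d" "\<lambda>r. y r \<bullet> v t"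
          "\<lambda>r. p r * (v r \<bullet> v t)"])
        fix r assume r: "r \<in> ball t d"
        have "((\<lambda>r. y r \<bullet> v t) has_vector_derivative (p r *\<^sub>R v r) \<bullet> v t) (at r)"
          using bounded_linear.has_vector_derivative[OF bounded_linear_inner_left der] d r by blast
        then show "((\<lambda>r. y r \<bullet> v t) has_real_derivative p r * (v r \<bullet> v t)) (at r)"
          by (simp add: has_real_derivative_iff_has_vector_derivative)
        show "p r * (v r \<bullet> v t) \<noteq> 0"
          using d[OF r] nz[of r] by auto
      qed (use that \<open>d > 0\<close> in \<open>auto simp: is_interval_ball_real\<close>)
      then show ?thesis
        using d[OF that] d[of t] \<open>d > 0\<close> by (simp add: sgn_mult)
    qed
    then show "\<forall>\<^sub>F s in at t within I. sgn (p t) = sgn (p s)"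
      using \<open>d > 0\<close> unfolding eventually_at by (auto simp: dist_commute)
  qed
qed fact+

text \<open>The involute conditions kill the first three frame components of the derivative; the
  \<open>V\<^sub>4\<close> component can only come from differentiating \<open>V\<^sub>3\<close> in
  the last summand.\<close>

lemma involute3_has_vector_derivative:
  assumes "open I"
    and unit: "\<forall>s\<in>I. speed x s = 1"
    and F: "frenet_on I x V\<^sub>1 V\<^sub>2 V\<^sub>3 V\<^sub>4 \<kappa>\<^sub>1 \<kappa>\<^sub>2 \<kappa>\<^sub>3"
    and inv: "involute3_on I x V\<^sub>1 V\<^sub>2 V\<^sub>3 l\<^sub>1 l\<^sub>2 l\<^sub>3 z"
    and s: "s \<in> I"
  shows "(z has_vector_derivative (l\<^sub>3 s * \<kappa>\<^sub>3 s) *\<^sub>R V\<^sub>4 s) (at s)"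
proof -
  have on: "orthonormal4 (V\<^sub>1 s) (V\<^sub>2 s) (V\<^sub>3 s) (V\<^sub>4 s)"
    and V1: "V\<^sub>1 s = vector_derivative x (at s)"
    and dV: "(V\<^sub>1 has_vector_derivative \<kappa>\<^sub>1 s *\<^sub>R V\<^sub>2 s) (at s)"
      "(V\<^sub>2 has_vector_derivative - \<kappa>\<^sub>1 s *\<^sub>R V\<^sub>1 s + \<kappa>\<^sub>2 s *\<^sub>R V\<^sub>3 s) (at s)"
      "(V\<^sub>3 has_vector_derivative - \<kappa>\<^sub>2 s *\<^sub>R V\<^sub>2 s + \<kappa>\<^sub>3 s *\<^sub>R V\<^sub>4 s) (at s)"
    and "x differentiable (at s)"
    using F unit s by (auto simp: frenet_on_def regular_curve_on_def)
  then have dx: "(x has_vector_derivative V\<^sub>1 s) (at s)"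
    by (simp add: vector_derivative_works)
  obtain m1 m2 m3 where dl: "(l\<^sub>1 has_real_derivative m1) (at s)"
      "(l\<^sub>2 has_real_derivative m2) (at s)" "(l\<^sub>3 has_real_derivative m3) (at s)"
    using inv s unfolding involute3_on_def real_differentiable_def by blast
  have perp: "vector_derivative z (at s) \<bullet> V\<^sub>1 s = 0" "vector_derivative z (at s) \<bullet> V\<^sub>2 s = 0"
      "vector_derivative z (at s) \<bullet> V\<^sub>3 s = 0"
    using inv s unfolding involute3_on_def by blast+
  \<comment> \<open>These are the first three frame coefficients of the derivative; their vanishing
    is the differential system for the \<lambda> functions of an involute of order 3.\<close>
  define a b c where "a = 1 + m1 - l\<^sub>2 s * \<kappa>\<^sub>1 s" and "b = l\<^sub>1 s * \<kappa>\<^sub>1 s + m2 - l\<^sub>3 s * \<kappa>\<^sub>2 s"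
    and "c = l\<^sub>2 s * \<kappa>\<^sub>2 s + m3"
  let ?D = "a *\<^sub>R V\<^sub>1 s + b *\<^sub>R V\<^sub>2 s + c *\<^sub>R V\<^sub>3 s + (l\<^sub>3 s * \<kappa>\<^sub>3 s) *\<^sub>R V\<^sub>4 s"
  have "((\<lambda>s. x s + l\<^sub>1 s *\<^sub>R V\<^sub>1 s + l\<^sub>2 s *\<^sub>R V\<^sub>2 s + l\<^sub>3 s *\<^sub>R V\<^sub>3 s) has_vector_derivative
      V\<^sub>1 s + (l\<^sub>1 s *\<^sub>R (\<kappa>\<^sub>1 s *\<^sub>R V\<^sub>2 s) + m1 *\<^sub>R V\<^sub>1 s)
      + (l\<^sub>2 s *\<^sub>R (- \<kappa>\<^sub>1 s *\<^sub>R V\<^sub>1 s + \<kappa>\<^sub>2 s *\<^sub>R V\<^sub>3 s) + m2 *\<^sub>R V\<^sub>2 s)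
      + (l\<^sub>3 s *\<^sub>R (- \<kappa>\<^sub>2 s *\<^sub>R V\<^sub>2 s + \<kappa>\<^sub>3 s *\<^sub>R V\<^sub>4 s) + m3 *\<^sub>R V\<^sub>3 s)) (at s)"
    by (intro has_vector_derivative_add has_vector_derivative_scaleR dx dV dl)
  also have "V\<^sub>1 s + (l\<^sub>1 s *\<^sub>R (\<kappa>\<^sub>1 s *\<^sub>R V\<^sub>2 s) + m1 *\<^sub>R V\<^sub>1 s)
      + (l\<^sub>2 s *\<^sub>R (- \<kappa>\<^sub>1 s *\<^sub>R V\<^sub>1 s + \<kappa>\<^sub>2 s *\<^sub>R V\<^sub>3 s) + m2 *\<^sub>R V\<^sub>2 s)
      + (l\<^sub>3 s *\<^sub>R (- \<kappa>\<^sub>2 s *\<^sub>R V\<^sub>2 s + \<kappa>\<^sub>3 s *\<^sub>R V\<^sub>4 s) + m3 *\<^sub>R V\<^sub>3 s) = ?D"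
    by (simp add: a_def b_def c_def algebra_simps)
  \<comment> \<open>The formula for \<open>z\<close> holds only on \<open>I\<close>; openness of
    \<open>I\<close> makes this enough for the derivative at \<open>s\<close>.\<close>
  finally have dz: "(z has_vector_derivative ?D) (at s)"
    by (rule has_vector_derivative_transform_within_open[OF _ \<open>open I\<close> s])
      (use inv in \<open>simp add: involute3_on_def\<close>)
  then have "vector_derivative z (at s) = ?D"
    by (rule vector_derivative_at)
  moreover have "V\<^sub>1 s \<bullet> V\<^sub>1 s = 1" "V\<^sub>2 s \<bullet> V\<^sub>2 s = 1" "V\<^sub>3 s \<bullet> V\<^sub>3 s = 1"
    "V\<^sub>2 s \<bullet> V\<^sub>1 s = 0" "V\<^sub>3 s \<bullet> V\<^sub>1 s = 0" "V\<^sub>4 s \<bullet> V\<^sub>1 s = 0"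
    "V\<^sub>1 s \<bullet> V\<^sub>2 s = 0" "V\<^sub>3 s \<bullet> V\<^sub>2 s = 0" "V\<^sub>4 s \<bullet> V\<^sub>2 s = 0"
    "V\<^sub>1 s \<bullet> V\<^sub>3 s = 0" "V\<^sub>2 s \<bullet> V\<^sub>3 s = 0" "V\<^sub>4 s \<bullet> V\<^sub>3 s = 0"
    using on by (auto simp: orthonormal4_def orthogonal_def norm_eq_1 inner_commute)
  ultimately have "a = 0" "b = 0" "c = 0"
    using perp by (simp_all add: inner_add_left)
  with dz show ?thesis by simp
qed

text \<open>The unit tangent of the involute is \<open>V\<^sub>4\<close> or its negative, according
  to the sign of \<psi>, hence two alternatives. Their frames differ by negating all four vectors,
  which leaves the Frenet equations, being linear in the frame, valid with the same
  curvatures.\<close>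

theorem proposition15:
  fixes I :: "real set"
    and x xbar V\<^sub>1 V\<^sub>2 V\<^sub>3 V\<^sub>4 :: "real \<Rightarrow> real ^ 4"
    and \<kappa>\<^sub>1 \<kappa>\<^sub>2 \<kappa>\<^sub>3 l\<^sub>1 l\<^sub>2 l\<^sub>3 \<psi> :: "real \<Rightarrow> real"
  assumes "open I" and "is_interval I"
    and "regular_curve_on I x"
    and "\<forall>s\<in>I. speed x s = 1"
    and "frenet_on I x V\<^sub>1 V\<^sub>2 V\<^sub>3 V\<^sub>4 \<kappa>\<^sub>1 \<kappa>\<^sub>2 \<kappa>\<^sub>3"
    and "\<forall>s\<in>I. \<kappa>\<^sub>1 s \<noteq> 0 \<and> \<kappa>\<^sub>2 s \<noteq> 0 \<and> \<kappa>\<^sub>3 s \<noteq> 0"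
    and "involute3_on I x V\<^sub>1 V\<^sub>2 V\<^sub>3 l\<^sub>1 l\<^sub>2 l\<^sub>3 xbar"
    and "regular_curve_on I xbar"
    and "\<forall>s\<in>I. \<psi> s = l\<^sub>3 s * \<kappa>\<^sub>3 s"
  shows "((\<forall>s\<in>I. \<psi> s > 0) \<and>
          frenet_on I xbar V\<^sub>4 (\<lambda>s. - V\<^sub>3 s) V\<^sub>2 V\<^sub>1
            (\<lambda>s. \<kappa>\<^sub>3 s / \<bar>\<psi> s\<bar>) (\<lambda>s. \<kappa>\<^sub>2 s / \<bar>\<psi> s\<bar>) (\<lambda>s. - (\<kappa>\<^sub>1 s / \<bar>\<psi> s\<bar>)))
       \<or> ((\<forall>s\<in>I. \<psi> s < 0) \<and>
          frenet_on I xbar (\<lambda>s. - V\<^sub>4 s) V\<^sub>3 (\<lambda>s. - V\<^sub>2 s) (\<lambda>s. - V\<^sub>1 s)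
            (\<lambda>s. \<kappa>\<^sub>3 s / \<bar>\<psi> s\<bar>) (\<lambda>s. \<kappa>\<^sub>2 s / \<bar>\<psi> s\<bar>) (\<lambda>s. - (\<kappa>\<^sub>1 s / \<bar>\<psi> s\<bar>)))"
proof -
  note F = assms(5)[unfolded frenet_on_def, THEN conjunct2, rule_format]
  have on: "orthonormal4 (V\<^sub>1 s) (V\<^sub>2 s) (V\<^sub>3 s) (V\<^sub>4 s)"
    and dV: "(V\<^sub>1 has_vector_derivative \<kappa>\<^sub>1 s *\<^sub>R V\<^sub>2 s) (at s)"
      "(V\<^sub>2 has_vector_derivative - \<kappa>\<^sub>1 s *\<^sub>R V\<^sub>1 s + \<kappa>\<^sub>2 s *\<^sub>R V\<^sub>3 s) (at s)"
      "(V\<^sub>3 has_vector_derivative - \<kappa>\<^sub>2 s *\<^sub>R V\<^sub>2 s + \<kappa>\<^sub>3 s *\<^sub>R V\<^sub>4 s) (at s)"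
      "(V\<^sub>4 has_vector_derivative - \<kappa>\<^sub>3 s *\<^sub>R V\<^sub>3 s) (at s)" if "s \<in> I" for s
    using F[OF that] assms(4) that by auto
  have dz: "(xbar has_vector_derivative \<psi> s *\<^sub>R V\<^sub>4 s) (at s)" if "s \<in> I" for s
    using involute3_has_vector_derivative[OF assms(1,4,5,7) that] assms(9) that by simp
  then have vd: "vector_derivative xbar (at s) = \<psi> s *\<^sub>R V\<^sub>4 s" if "s \<in> I" for s
    using that vector_derivative_at by blast
  \<comment> \<open>Regularity of the involute is exactly what excludes zeros of \<psi>.\<close>
  then have nz: "\<psi> s *\<^sub>R V\<^sub>4 s \<noteq> 0" if "s \<in> I" for s
    using assms(8) that by (auto simp: regular_curve_on_def)
  have sp: "speed xbar s = \<bar>\<psi> s\<bar>" if "s \<in> I" for s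
    using vd[OF that] on[OF that] by (simp add: speed_def orthonormal4_def)
  have "continuous_on I V\<^sub>4"
    using dV(4) by (meson continuous_at_imp_continuous_on has_vector_derivative_continuous)
  then have "sgn (\<psi> s) = sgn (\<psi> t)" if "s \<in> I" "t \<in> I" for s t
    using vector_derivative_direction_sgn_eq[OF assms(1,2) dz] nz that by blast
  then consider "\<forall>s\<in>I. \<psi> s > 0" | "\<forall>s\<in>I. \<psi> s < 0"
    using nz by (metis linorder_neqE_linordered_idom scale_eq_0_iff sgn_greater sgn_less)
  then show ?thesis
  proof cases
    case 1
    have "frenet_on I xbar V\<^sub>4 (\<lambda>s. - V\<^sub>3 s) V\<^sub>2 V\<^sub>1
        (\<lambda>s. \<kappa>\<^sub>3 s / \<bar>\<psi> s\<bar>) (\<lambda>s. \<kappa>\<^sub>2 s / \<bar>\<psi> s\<bar>) (\<lambda>s. - (\<kappa>\<^sub>1 s / \<bar>\<psi> s\<bar>))"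
      unfolding frenet_on_def
    proof (intro conjI ballI assms(8))
      fix s assume s: "s \<in> I"
      with 1 have pos: "\<psi> s > 0" by blast
      show "orthonormal4 (V\<^sub>4 s) (- V\<^sub>3 s) (V\<^sub>2 s) (V\<^sub>1 s)"
        using on[OF s] by (auto simp: orthonormal4_def orthogonal_def inner_commute)
      show "V\<^sub>4 s = vector_derivative xbar (at s) /\<^sub>R speed xbar s"
        using pos by (simp add: vd sp s)
      \<comment> \<open>Once distributed over the sums, the speed cancels the denominators of the
        new curvatures, leaving the Frenet equations of \<open>x\<close> up to sign.\<close>
      note rescale = sp[OF s] scaleR_right_distrib scaleR_right_diff_distrib
      show "(V\<^sub>4 has_vector_derivative
          speed xbar s *\<^sub>R ((\<kappa>\<^sub>3 s / \<bar>\<psi> s\<bar>) *\<^sub>R - V\<^sub>3 s)) (at s)"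
        using dV(4)[OF s] pos by (simp add: rescale)
      show "((\<lambda>s. - V\<^sub>3 s) has_vector_derivative
          speed xbar s *\<^sub>R (- (\<kappa>\<^sub>3 s / \<bar>\<psi> s\<bar>) *\<^sub>R V\<^sub>4 s + (\<kappa>\<^sub>2 s / \<bar>\<psi> s\<bar>) *\<^sub>R V\<^sub>2 s)) (at s)"
        using has_vector_derivative_minus[OF dV(3)[OF s]] pos by (simp add: rescale)
      show "(V\<^sub>2 has_vector_derivative
          speed xbar s *\<^sub>R (- (\<kappa>\<^sub>2 s / \<bar>\<psi> s\<bar>) *\<^sub>R - V\<^sub>3 s + - (\<kappa>\<^sub>1 s / \<bar>\<psi> s\<bar>) *\<^sub>R V\<^sub>1 s)) (at s)"
        using dV(2)[OF s] pos by (simp add: rescale)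
      \<comment> \<open>The fourth Frenet equation carries a minus sign while the derivative of
        \<open>V\<^sub>1\<close> is a positive multiple of
        \<open>\<kappa>\<^sub>1 s *\<^sub>R V\<^sub>2 s\<close>; this forces the negative third
        curvature.\<close>
      show "(V\<^sub>1 has_vector_derivative
          speed xbar s *\<^sub>R (- (- (\<kappa>\<^sub>1 s / \<bar>\<psi> s\<bar>)) *\<^sub>R V\<^sub>2 s)) (at s)"
        using dV(1)[OF s] pos by (simp add: rescale)
    qed
    with 1 show ?thesis by blast
  next
    case 2
    \<comment> \<open>For negative \<psi> the derivative of \<open>xbar\<close> points along the
      negative of \<open>V\<^sub>4\<close>, so the whole frame of the first case is
      reversed.\<close>
    have "frenet_on I xbar (\<lambda>s. - V\<^sub>4 s) V\<^sub>3 (\<lambda>s. - V\<^sub>2 s) (\<lambda>s. - V\<^sub>1 s)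
        (\<lambda>s. \<kappa>\<^sub>3 s / \<bar>\<psi> s\<bar>) (\<lambda>s. \<kappa>\<^sub>2 s / \<bar>\<psi> s\<bar>) (\<lambda>s. - (\<kappa>\<^sub>1 s / \<bar>\<psi> s\<bar>))"
      unfolding frenet_on_def
    proof (intro conjI ballI assms(8))
      fix s assume s: "s \<in> I"
      with 2 have neg: "\<psi> s < 0" by blast
      show "orthonormal4 (- V\<^sub>4 s) (V\<^sub>3 s) (- V\<^sub>2 s) (- V\<^sub>1 s)"
        using on[OF s] by (auto simp: orthonormal4_def orthogonal_def inner_commute)
      show "- V\<^sub>4 s = vector_derivative xbar (at s) /\<^sub>R speed xbar s"
        using neg by (simp add: vd sp s)
      note rescale = sp[OF s] scaleR_right_distrib scaleR_right_diff_distrib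
      show "((\<lambda>s. - V\<^sub>4 s) has_vector_derivative
          speed xbar s *\<^sub>R ((\<kappa>\<^sub>3 s / \<bar>\<psi> s\<bar>) *\<^sub>R V\<^sub>3 s)) (at s)"
        using has_vector_derivative_minus[OF dV(4)[OF s]] neg by (simp add: rescale)
      show "(V\<^sub>3 has_vector_derivative
          speed xbar s *\<^sub>R (- (\<kappa>\<^sub>3 s / \<bar>\<psi> s\<bar>) *\<^sub>R - V\<^sub>4 s + (\<kappa>\<^sub>2 s / \<bar>\<psi> s\<bar>) *\<^sub>R - V\<^sub>2 s)) (at s)"
        using dV(3)[OF s] neg by (simp add: rescale)
      show "((\<lambda>s. - V\<^sub>2 s) has_vector_derivative
          speed xbar s *\<^sub>R (- (\<kappa>\<^sub>2 s / \<bar>\<psi> s\<bar>) *\<^sub>R V\<^sub>3 s + - (\<kappa>\<^sub>1 s / \<bar>\<psi> s\<bar>) *\<^sub>R - V\<^sub>1 s)) (at s)"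
        using has_vector_derivative_minus[OF dV(2)[OF s]] neg by (simp add: rescale)
      show "((\<lambda>s. - V\<^sub>1 s) has_vector_derivative
          speed xbar s *\<^sub>R (- (- (\<kappa>\<^sub>1 s / \<bar>\<psi> s\<bar>)) *\<^sub>R - V\<^sub>2 s)) (at s)"
        using has_vector_derivative_minus[OF dV(1)[OF s]] neg by (simp add: rescale)
    qed
    with 2 show ?thesis by blast
  qed
qed

end
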